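(* Let $a,h,d,b$ be positive integers with $b\ge3$ and $\gcd(a,d)=1$, and let $A(a)=(a,ha+d,ha+bd,ha+(2b-1)d)$. Suppose $h\ge\left\lceil\frac{d}{b-2}\right\rceil$ and $a\ge 2b^2-5b+2$. Writing $Q=\left\lfloor\frac{a}{2b-1}\right\rfloor$, we have $$g(A(a))=\begin{cases}(Q+b-2)ha+(2b-1)dQ-a-d & \text{if } a\equiv 0,1,\dots,b-2\pmod{2b-1},\\ (Q+b-2)ha+(2b-1)dQ-a+(b-2)d & \text{if } a\equiv b-1\pmod{2b-1},\\ (Q+b-1)ha+(2b-1)dQ-a+(b-1)d & \text{if } a\equiv b,\dots,2b-2\pmod{2b-1}.\end{cases}$$
   Context: For positive integers $a_1,\dots,a_n$ with $\gcd=1$, the Frobenius number $g(a_1,\dots,a_n)$ is the largest integer not representable as $\sum x_ia_i$ with nonnegative integers $x_i$. *)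

theory Defs
  imports Complex_Main "HOL-Number_Theory.Cong"
begin

definition representable :: "nat list \<Rightarrow> int \<Rightarrow> bool" where
  "representable as m \<longleftrightarrow> (\<exists>x :: nat \<Rightarrow> nat. m = (\<Sum>i<length as. int (x i) * int (as ! i)))"

text \<open>
  The maximum is taken over all integers, so the set of non-representable numbers always contains
  the negative ones; for a list of positive integers with greatest common divisor 1 it is bounded
  above and the maximum exists. For other lists the value is unspecified.
\<close>

definition frobenius_number :: "nat list \<Rightarrow> int" where
  "frobenius_number as = (GREATEST m. \<not> representable as m)"

lemma frobenius_number_eqI:
  assumes "\<not> representable as g" and "\<And>m. g < m \<Longrightarrow> representable as m"
  shows "frobenius_number as = g"
  unfolding frobenius_number_def
  using assms by (intro Greatest_equality) (auto simp: not_less[symmetric])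

end

theory Submission
  imports Defs
begin

text \<open>
  Put \<open>K = 2b - 1\<close>. A representable number is \<open>x\<^sub>0 a + s h a + t d\<close> where \<open>t\<close> is paid with \<open>s\<close> coins
  of values \<open>1, b, K\<close>. As \<open>d\<close> is invertible modulo \<open>a\<close>, every residue class contains exactly one
  \<open>t d\<close> with \<open>0 \<le> t < a\<close>, and the Frobenius number is the largest of the minimal elements of the
  classes, minus \<open>a\<close>. Paying \<open>t\<close> greedily gives the upper bound: the greedy coin count is largest
  for remainders \<open>b - 1\<close> and \<open>2b - 2\<close> modulo \<open>K\<close>. For the lower bound, doubling the
  equation for \<open>t\<close> shows that the greedy payment of the extremal \<open>t\<close> is optimal, and
  \<open>a \<ge> (b - 2) K\<close> shows that replacing \<open>t\<close> by \<open>t + j a\<close> does not save coins.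
\<close>

section \<open>Reduction to minimal elements of residue classes modulo \<open>a\<close>\<close>

lemma representable_four_iff:
  "representable [p, q, r, s] m \<longleftrightarrow>
     (\<exists>x0 x1 x2 x3 :: nat. m = int (x0 * p + x1 * q + x2 * r + x3 * s))"
proof
  assume "representable [p, q, r, s] m"
  then obtain x :: "nat \<Rightarrow> nat"
    where "m = (\<Sum>i<length [p, q, r, s]. int (x i) * int ([p, q, r, s] ! i))"
    unfolding representable_def by blast
  then have "m = int (x 0 * p + x 1 * q + x 2 * r + x 3 * s)"
    by (simp add: eval_nat_numeral)
  then show "\<exists>x0 x1 x2 x3 :: nat. m = int (x0 * p + x1 * q + x2 * r + x3 * s)"
    by blast
next
  assume "\<exists>x0 x1 x2 x3 :: nat. m = int (x0 * p + x1 * q + x2 * r + x3 * s)"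
  then obtain x0 x1 x2 x3 :: nat where m: "m = int (x0 * p + x1 * q + x2 * r + x3 * s)"
    by blast
  show "representable [p, q, r, s] m"
    unfolding representable_def
    by (rule exI[of _ "\<lambda>i. [x0, x1, x2, x3] ! i"]) (simp add: m eval_nat_numeral)
qed

text \<open>\<open>lower\<close> makes \<open>C * h * a + T * d\<close> the least representable
  number in its class modulo \<open>a\<close>, so subtracting \<open>a\<close> leaves the
  representable numbers. \<open>upper\<close> puts a representable number no larger than this one
  into every class, and adding copies of \<open>a\<close> reaches everything beyond the claimed
  value.\<close>

lemma frobenius_number_eq_extremal_class:
  fixes a h d e k C T :: nat
  assumes a: "a > 0" and cop: "coprime a d" and T: "T < a"
    and upper: "\<And>t. t < a \<Longrightarrow> \<exists>x1 x2 x3. t = x1 + e * x2 + k * x3 \<and>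
          (x1 + x2 + x3) * h * a + t * d \<le> C * h * a + T * d"
    and lower: "\<And>x1 x2 x3 j. x1 + e * x2 + k * x3 = T + j * a \<Longrightarrow> C \<le> x1 + x2 + x3"
  shows "frobenius_number [a, h * a + d, h * a + e * d, h * a + k * d] =
           int C * int h * int a + int T * int d - int a"
proof (rule frobenius_number_eqI)
  let ?F = "int C * int h * int a + int T * int d - int a"
  show "\<not> representable [a, h * a + d, h * a + e * d, h * a + k * d] ?F"
  proof
    assume "representable [a, h * a + d, h * a + e * d, h * a + k * d] ?F"
    then obtain x0 x1 x2 x3 :: nat where
      "?F = int (x0 * a + x1 * (h * a + d) + x2 * (h * a + e * d) + x3 * (h * a + k * d))"
      unfolding representable_four_iff by blast
    moreover define t where "t = x1 + e * x2 + k * x3"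
    moreover define s where "s = x1 + x2 + x3"
    ultimately have F: "?F = int x0 * int a + int s * int h * int a + int t * int d"
      by (simp add: algebra_simps)
    then have eq: "(int t - int T) * int d = (int C * int h - 1 - int x0 - int s * int h) * int a"
      by (simp add: algebra_simps)
    then have "int a dvd (int t - int T) * int d" by simp
    with cop have "int a dvd int t - int T"
      by (simp add: coprime_dvd_mult_left_iff)
    then obtain j where j: "int t - int T = int a * j" ..
    \<comment> \<open>\<open>j \<le> -1\<close> would give \<open>t \<le> T - a < 0\<close>. Without
      this, \<open>lower\<close> could not be applied to \<open>t = T + j * a\<close>.\<close>
    have "j \<ge> 0"
    proof (rule ccontr)
      assume "\<not> j \<ge> 0"
      then have "int a * j \<le> int a * (- 1)" by (intro mult_left_mono) auto
      with j T show False by simp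
    qed
    then obtain j' where j': "j = int j'" by (rule nonneg_int_cases)
    have "int t = int (T + j' * a)"
      using j j' by (simp add: algebra_simps)
    then have "x1 + e * x2 + k * x3 = T + j' * a"
      unfolding t_def by (simp only: of_nat_eq_iff)
    then have "C \<le> s" unfolding s_def by (rule lower)
    \<comment> \<open>After cancelling \<open>a\<close> the left side is nonnegative, while
      \<open>C \<le> s\<close> makes the right side at most \<open>-1 - x0\<close>.\<close>
    have "(j * int d) * int a = (int C * int h - 1 - int x0 - int s * int h) * int a"
      using eq j by (simp add: algebra_simps)
    then have "j * int d = int C * int h - 1 - int x0 - int s * int h"
      using a by simp
    moreover have "j * int d \<ge> 0" using j' by simp
    moreover have "int C * int h \<le> int s * int h"
      using \<open>C \<le> s\<close> by (simp add: mult_right_mono)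
    ultimately show False by linarith
  qed
next
  fix m :: int
  assume m: "int C * int h * int a + int T * int d - int a < m"
  \<comment> \<open>The inverse \<open>u\<close> of \<open>d\<close> modulo \<open>a\<close> selects
    the \<open>t < a\<close> for which \<open>t * d\<close> lies in the class of
    \<open>m\<close>.\<close>
  obtain u where u: "[int d * u = 1] (mod int a)"
    using cong_solve_coprime_int[of "int d" "int a"] cop by (auto simp: coprime_commute)
  define t where "t = nat ((m * u) mod int a)"
  have t: "int t = (m * u) mod int a" using a by (simp add: t_def)
  have "t < a" using a by (simp add: t_def nat_less_iff)
  have "[int t = m * u] (mod int a)" by (simp add: t)
  then have "[int t * int d = m * u * int d] (mod int a)"
    by (rule cong_scalar_right)
  moreover have "[m * (int d * u) = m * 1] (mod int a)"
    using u by (rule cong_scalar_left)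
  ultimately have tm: "[int t * int d = m] (mod int a)"
    by (metis cong_trans mult.assoc mult.commute mult_1_right)
  obtain x1 x2 x3 where x: "t = x1 + e * x2 + k * x3"
    and le: "(x1 + x2 + x3) * h * a + t * d \<le> C * h * a + T * d"
    using upper[OF \<open>t < a\<close>] by blast
  let ?w = "int (x1 + x2 + x3) * int h * int a + int t * int d"
  have "int ((x1 + x2 + x3) * h * a + t * d) \<le> int (C * h * a + T * d)"
    using le by (simp only: of_nat_le_iff)
  then have "?w \<le> int C * int h * int a + int T * int d" by simp
  with m have w: "?w - int a < m" by linarith
  have "int a dvd m - int t * int d"
    using tm by (metis cong_iff_dvd_diff cong_sym)
  then have "int a dvd m - ?w"
    by (metis diff_diff_add add.commute dvd_diff dvd_triv_right)
  then obtain y where y: "m - ?w = int a * y" ..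
  \<comment> \<open>The strict bound \<open>?w - a < m\<close> gives \<open>a * y > -a\<close>,
    which excludes \<open>y \<le> -1\<close>.\<close>
  have "y \<ge> 0"
  proof (rule ccontr)
    assume "\<not> y \<ge> 0"
    then have "int a * y \<le> int a * (- 1)" by (intro mult_left_mono) auto
    with y w show False by simp
  qed
  then obtain x0 where x0: "y = int x0" by (rule nonneg_int_cases)
  have "m = int (x0 * a + x1 * (h * a + d) + x2 * (h * a + e * d) + x3 * (h * a + k * d))"
    using y unfolding x0 x by (simp add: algebra_simps)
  then show "representable [a, h * a + d, h * a + e * d, h * a + k * d] m"
    unfolding representable_four_iff by blast
qed

section \<open>Greedy payments and lower bounds on coin counts\<close>

text \<open>Number of coins used when paying \<open>t\<close> with coins \<open>2 * b - 1\<close>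
  first, then at most one coin \<open>b\<close>, then ones. A remainder costs at most
  \<open>b - 1\<close> coins, attained at \<open>b - 1\<close> and \<open>2 * b - 2\<close>.\<close>

definition greedy_count :: "nat \<Rightarrow> nat \<Rightarrow> nat" where
  "greedy_count b t = t div (2 * b - 1) +
     (let r = t mod (2 * b - 1) in if r < b then r else r - b + 1)"

lemma greedy_payment:
  "\<exists>x1 x2 x3. t = x1 + b * x2 + (2 * b - 1) * x3 \<and> x1 + x2 + x3 = greedy_count b t"
proof (cases "t mod (2 * b - 1) < b")
  case True
  then show ?thesis
    by (intro exI[of _ "t mod (2 * b - 1)"] exI[of _ 0] exI[of _ "t div (2 * b - 1)"])
      (simp add: greedy_count_def)
next
  case False
  then show ?thesis
    by (intro exI[of _ "t mod (2 * b - 1) - b"] exI[of _ 1] exI[of _ "t div (2 * b - 1)"])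
      (simp add: greedy_count_def)
qed

text \<open>
  With \<open>u = 2 x\<^sub>1 + x\<^sub>2\<close> and \<open>v = x\<^sub>2 + 2 x\<^sub>3\<close> the doubled value is \<open>u + (2b - 1) v\<close> and the
  doubled coin count is \<open>u + v\<close>, so few coins means large \<open>v\<close>, and \<open>v \<le> n\<close> below.
\<close>

lemma coin_count_ge:
  fixes b n r x1 x2 x3 :: nat
  assumes "b > 0" and r: "r < 2 * b - 1"
    and eq: "2 * (x1 + b * x2 + (2 * b - 1) * x3) = (2 * b - 1) * n + r"
  shows "n + r \<le> 2 * (x1 + x2 + x3)"
proof -
  define K where "K = 2 * b - 1"
  define u v where "u = 2 * x1 + x2" and "v = x2 + 2 * x3"
  have K: "2 * b = K + 1" "K \<ge> 1" using \<open>b > 0\<close> by (auto simp: K_def)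
  have "2 * (x1 + b * x2 + K * x3) = 2 * x1 + (2 * b) * x2 + 2 * K * x3"
    by (simp add: algebra_simps)
  also have "\<dots> = u + K * v" unfolding K(1) by (simp add: u_def v_def algebra_simps)
  finally have uv: "u + K * v = K * n + r" using eq by (simp add: K_def)
  have "v \<le> n"
  proof (rule ccontr)
    assume "\<not> v \<le> n"
    then have "K * (n + 1) \<le> K * v" by (intro mult_left_mono) auto
    moreover have "r < K" using r by (simp add: K_def)
    ultimately show False using uv by simp
  qed
  \<comment> \<open>Lowering \<open>v\<close> by \<open>i\<close> raises \<open>u\<close> by
    \<open>K * i \<ge> i\<close>, so the sum \<open>u + v\<close> cannot drop below
    \<open>n + r\<close>.\<close>
  then obtain i where n: "n = v + i" using le_Suc_ex by blast
  have "u = K * i + r" using uv by (simp add: n algebra_simps)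
  moreover have "i \<le> K * i" using K(2) by simp
  ultimately have "n + r \<le> u + v" by (simp add: n)
  then show ?thesis by (simp add: u_def v_def)
qed

text \<open>No coin is worth more than \<open>2 * b - 1\<close>.\<close>

lemma coin_count_ge_of_value:
  fixes b n x1 x2 x3 :: nat
  assumes "b > 0" and "(2 * b - 1) * n < x1 + b * x2 + (2 * b - 1) * x3"
  shows "n < x1 + x2 + x3"
proof -
  have "x1 + b * x2 + (2 * b - 1) * x3 \<le> (2 * b - 1) * x1 + (2 * b - 1) * x2 + (2 * b - 1) * x3"
    using \<open>b > 0\<close> by (intro add_mono mult_right_mono) auto
  with assms(2) have "(2 * b - 1) * n < (2 * b - 1) * (x1 + x2 + x3)"
    by (simp add: distrib_left)
  then show ?thesis by simp
qed

section \<open>Criterion for an extremal value \<open>T\<close>\<close>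

text \<open>A value \<open>t\<close> above \<open>T\<close> exceeds it by at most
  \<open>b - 2\<close>, which costs at most \<open>(b - 2) * d \<le> h * a\<close>, and this is
  covered by the coin it saves. The choice \<open>2 * C = n + r\<close> matches the bound from the
  doubled equation, so \<open>C\<close> coins are optimal for \<open>T\<close>. \<open>CT\<close>
  together with the bound on \<open>a\<close> handles \<open>T + j * a\<close> for
  \<open>j > 0\<close>.\<close>

lemma frobenius_number_eq_of_extremal_value:
  fixes a h d b C T n r :: nat
  assumes "b \<ge> 3" and cop: "coprime a d" and a: "(2 * b - 1) * (b - 2) \<le> a"
    and small: "(b - 2) * d \<le> h * a" and T: "T < a"
    and Tn: "2 * T = (2 * b - 1) * n + r" and r: "r < 2 * b - 1" and C: "2 * C = n + r"
    and CT: "(2 * b - 1) * (C + 1) < T + (2 * b - 1) * b"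
    and count: "\<And>t. t < a \<Longrightarrow> greedy_count b t \<le> C"
    and count_less: "\<And>t. T < t \<Longrightarrow> t < a \<Longrightarrow> greedy_count b t < C \<and> t \<le> T + (b - 2)"
  shows "frobenius_number [a, h * a + d, h * a + b * d, h * a + (2 * b - 1) * d] =
           int C * int h * int a + int T * int d - int a"
proof (rule frobenius_number_eq_extremal_class[OF _ cop T])
  show "a > 0" using T by simp
next
  fix t assume "t < a"
  have "greedy_count b t * h * a + t * d \<le> C * h * a + T * d"
  proof (cases "t \<le> T")
    case True
    then show ?thesis using count[OF \<open>t < a\<close>] by (intro add_mono mult_right_mono) auto
  next
    case False
    then have less: "greedy_count b t + 1 \<le> C" "t \<le> T + (b - 2)"
      using count_less[of t] \<open>t < a\<close> by auto
    have "t * d \<le> (T + (b - 2)) * d" using less(2) by (rule mult_right_mono) simp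
    also have "\<dots> \<le> T * d + h * a" using small by (simp add: distrib_right)
    finally have "greedy_count b t * h * a + t * d \<le> (greedy_count b t + 1) * (h * a) + T * d"
      by (simp add: algebra_simps)
    also have "\<dots> \<le> C * (h * a) + T * d"
      using less(1) by (intro add_mono mult_right_mono) auto
    finally show ?thesis by (simp add: mult.assoc)
  qed
  then show "\<exists>x1 x2 x3. t = x1 + b * x2 + (2 * b - 1) * x3 \<and>
      (x1 + x2 + x3) * h * a + t * d \<le> C * h * a + T * d"
    using greedy_payment[of t b] by metis
next
  fix x1 x2 x3 j
  assume eq: "x1 + b * x2 + (2 * b - 1) * x3 = T + j * a"
  show "C \<le> x1 + x2 + x3"
  proof (cases "j = 0")
    case True
    with eq Tn have "2 * (x1 + b * x2 + (2 * b - 1) * x3) = (2 * b - 1) * n + r" by simp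
    from coin_count_ge[OF _ r this] C \<open>b \<ge> 3\<close> show ?thesis by simp
  next
    case False
    have "a \<le> j * a" using False by simp
    show ?thesis
    proof (cases "C = 0")
      case False
      \<comment> \<open>Writing \<open>b = (b - 2) + 2\<close> and
        \<open>C + 1 = (C - 1) + 2\<close> cancels \<open>2 * (2 * b - 1)\<close> from
        \<open>CT\<close> and exposes the lower bound on \<open>a\<close>.\<close>
      have "b - 2 + 2 = b" using \<open>b \<ge> 3\<close> by simp
      then have "(2 * b - 1) * b = (2 * b - 1) * (b - 2) + (2 * b - 1) * 2"
        by (metis distrib_left)
      moreover have "(2 * b - 1) * (C + 1) = (2 * b - 1) * (C - 1) + (2 * b - 1) * 2"
        unfolding distrib_left[symmetric] using False by simp
      ultimately have "(2 * b - 1) * (C - 1) < T + (2 * b - 1) * (b - 2)"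
        using CT by linarith
      also have "\<dots> \<le> x1 + b * x2 + (2 * b - 1) * x3"
        using a \<open>a \<le> j * a\<close> eq by linarith
      finally have "C - 1 < x1 + x2 + x3"
        by (rule coin_count_ge_of_value[rotated]) (use \<open>b \<ge> 3\<close> in simp)
      then show ?thesis by simp
    qed simp
  qed
qed

section \<open>Greedy counts below \<open>a\<close> and the three residue cases\<close>

lemma greedy_count_block:
  "s < 2 * b - 1 \<Longrightarrow>
     greedy_count b ((2 * b - 1) * q + s) = q + (if s < b then s else s - b + 1)"
  by (simp add: greedy_count_def)

text \<open>The quotient is at most \<open>q - 1\<close> and the remainder costs at most
  \<open>b - 1\<close> coins.\<close>

lemma greedy_count_below_block:
  assumes "b \<ge> 2" and "t < (2 * b - 1) * q"
  shows "greedy_count b t \<le> q + b - 2"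
proof -
  have "t div (2 * b - 1) < q"
    using assms(2) by (simp add: less_mult_imp_div_less mult.commute)
  moreover have "t mod (2 * b - 1) < 2 * b - 1" using \<open>b \<ge> 2\<close> by simp
  ultimately show ?thesis
    using \<open>b \<ge> 2\<close> unfolding greedy_count_def Let_def by (split if_split) linarith
qed

theorem theorem4p7:
  fixes a h d b :: nat and Q :: int
  assumes "a > 0" and "h > 0" and "d > 0" and "b \<ge> 3"
    and "gcd a d = 1"
    and "int h \<ge> \<lceil>real d / (real b - 2)\<rceil>"
    and "int a \<ge> 2 * int b ^ 2 - 5 * int b + 2"
    and "Q = \<lfloor>real a / (2 * real b - 1)\<rfloor>"
  shows "((\<exists>r\<in>{0..b - 2}. [a = r] (mod (2 * b - 1))) \<longrightarrow>
           frobenius_number [a, h * a + d, h * a + b * d, h * a + (2 * b - 1) * d] =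
             (Q + int b - 2) * int h * int a + (2 * int b - 1) * int d * Q - int a - int d) \<and>
         ([a = b - 1] (mod (2 * b - 1)) \<longrightarrow>
           frobenius_number [a, h * a + d, h * a + b * d, h * a + (2 * b - 1) * d] =
             (Q + int b - 2) * int h * int a + (2 * int b - 1) * int d * Q - int a
               + (int b - 2) * int d) \<and>
         ((\<exists>r\<in>{b..2 * b - 2}. [a = r] (mod (2 * b - 1))) \<longrightarrow>
           frobenius_number [a, h * a + d, h * a + b * d, h * a + (2 * b - 1) * d] =
             (Q + int b - 1) * int h * int a + (2 * int b - 1) * int d * Q - int a
               + (int b - 1) * int d)"
proof -
  define K where "K = 2 * b - 1"
  define q where "q = a div K"
  define r where "r = a mod K"
  have K: "K = 2 * b - 1" "K \<ge> 5" using \<open>b \<ge> 3\<close> by (auto simp: K_def)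
  have aq: "a = K * q + r" and r: "r < K"
    using K(2) by (simp_all add: q_def r_def)
  have Q: "Q = int q"
  proof -
    have "2 * real b - 1 = real K" using \<open>b \<ge> 3\<close> by (simp add: K_def of_nat_diff)
    then show ?thesis
      using assms(8) by (simp add: q_def floor_divide_of_nat_eq)
  qed
  have aK: "(2 * b - 1) * (b - 2) \<le> a"
  proof -
    have "int ((2 * b - 1) * (b - 2)) = (2 * int b - 1) * (int b - 2)"
      using \<open>b \<ge> 3\<close> by (simp add: of_nat_diff)
    also have "\<dots> = 2 * int b ^ 2 - 5 * int b + 2"
      by (simp add: algebra_simps power2_eq_square)
    finally have "int ((2 * b - 1) * (b - 2)) = 2 * int b ^ 2 - 5 * int b + 2" .
    with assms(7) show ?thesis by linarith
  qed
  have small: "(b - 2) * d \<le> h * a"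
  proof -
    have "real d / (real b - 2) \<le> real h" using assms(6) by (simp add: ceiling_le_iff)
    then have "real d \<le> real (h * (b - 2))"
      using \<open>b \<ge> 3\<close> by (simp add: divide_le_eq of_nat_diff)
    then have "d \<le> h * (b - 2)" by (simp only: of_nat_le_iff)
    \<comment> \<open>Enlarging \<open>b - 2\<close> to \<open>2 * b - 1\<close> produces the factor
      \<open>(2 * b - 1) * (b - 2)\<close>, which is bounded by \<open>a\<close>.\<close>
    then have "(b - 2) * d \<le> (2 * b - 1) * (h * (b - 2))"
      by (intro mult_mono) auto
    also have "\<dots> = h * ((2 * b - 1) * (b - 2))" by simp
    also have "\<dots> \<le> h * a" using aK by (rule mult_left_mono) simp
    finally show ?thesis .
  qed
  have q: "q \<ge> 1"
  proof -
    have "K * 1 \<le> K * (b - 2)" using \<open>b \<ge> 3\<close> by (intro mult_left_mono) auto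
    also have "\<dots> \<le> a" using aK by (simp add: K_def)
    finally show ?thesis using K(2) by (simp add: q_def div_greater_zero_iff Suc_le_eq)
  qed
  have Kq: "K * q \<ge> K" using q by simp
  have cop: "coprime a d" using \<open>gcd a d = 1\<close> by (simp add: coprime_iff_gcd_eq_1)
  \<comment> \<open>Below \<open>a\<close> there are \<open>q\<close> complete blocks of length
    \<open>K\<close> and a last block with remainders \<open>s < r\<close> only.\<close>
  have count: "t < K * q \<and> greedy_count b t \<le> q + b - 2 \<or>
      (\<exists>s<r. t = K * q + s \<and> greedy_count b t = q + (if s < b then s else s - b + 1))"
    if "t < a" for t
  proof (cases "t < K * q")
    case True
    then show ?thesis using greedy_count_below_block[of b t q] \<open>b \<ge> 3\<close> by (simp add: K_def)
  next
    case False
    then obtain s where s: "t = K * q + s" using le_Suc_ex not_less by blast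
    with that aq have "s < r" by simp
    with s r greedy_count_block[of s b q] show ?thesis by (auto simp: K_def)
  qed
  note main = frobenius_number_eq_of_extremal_value[OF \<open>b \<ge> 3\<close> cop aK small]
  have intK: "int K = 2 * int b - 1" using \<open>b \<ge> 3\<close> by (simp add: K_def of_nat_diff)
  have residue: "[a = s] (mod (2 * b - 1)) \<longleftrightarrow> r = s" if "s < K" for s
    using that by (simp add: cong_def r_def K_def)
  have case1: "frobenius_number [a, h * a + d, h * a + b * d, h * a + (2 * b - 1) * d] =
      int (q + b - 2) * int h * int a + int (K * q - 1) * int d - int a" if "r \<le> b - 2"
  \<comment> \<open>\<open>T = K * q - 1\<close> ends the last complete block, with remainder
    \<open>2 * b - 2\<close>. In the incomplete block \<open>s \<le> b - 3\<close>, so each larger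
    \<open>t\<close> saves a coin.\<close>
  proof (rule main[where n = "2 * q - 1" and r = "K - 2"])
    show "K * q - 1 < a" using aq Kq K(2) by linarith
    have "K * (2 * q - 1) + K = K * (2 * q)" using q by (simp add: diff_mult_distrib2)
    then show "2 * (K * q - 1) = (2 * b - 1) * (2 * q - 1) + (K - 2)"
      unfolding K(1)[symmetric] using K(2) Kq by (simp add: mult.left_commute)
    show "K - 2 < 2 * b - 1" using K by simp
    show "2 * (q + b - 2) = 2 * q - 1 + (K - 2)" using q \<open>b \<ge> 3\<close> by (simp add: K_def)
    have "q + b - 2 + 1 + 1 = q + b" using \<open>b \<ge> 3\<close> by simp
    then have "K * (q + b - 2 + 1) + K = K * q + K * b"
      by (metis distrib_left mult.right_neutral)
    then show "(2 * b - 1) * (q + b - 2 + 1) < K * q - 1 + (2 * b - 1) * b"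
      unfolding K(1)[symmetric] using K(2) Kq by linarith
    show "greedy_count b t \<le> q + b - 2" if "t < a" for t
      using count[OF that] \<open>r \<le> b - 2\<close> by auto
    show "greedy_count b t < q + b - 2 \<and> t \<le> K * q - 1 + (b - 2)" if "K * q - 1 < t" "t < a" for t
      using count[OF that(2)] that(1) \<open>r \<le> b - 2\<close> by auto
  qed
  have case2: "frobenius_number [a, h * a + d, h * a + b * d, h * a + (2 * b - 1) * d] =
      int (q + b - 2) * int h * int a + int (K * q + b - 2) * int d - int a" if "r = b - 1"
  \<comment> \<open>The remainder \<open>b - 2\<close> is now available and ties the maximal count
    \<open>q + b - 2\<close> at a larger value. Since \<open>T = a - 1\<close>, no \<open>t\<close>
    lies above it.\<close>
  proof (rule main[where n = "2 * q" and r = "2 * b - 4"])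
    show "K * q + b - 2 < a" using aq that \<open>b \<ge> 3\<close> by linarith
    show "2 * (K * q + b - 2) = (2 * b - 1) * (2 * q) + (2 * b - 4)"
      unfolding K(1)[symmetric] using \<open>b \<ge> 3\<close> by (simp add: mult.left_commute)
    show "2 * b - 4 < 2 * b - 1" using \<open>b \<ge> 3\<close> by simp
    show "2 * (q + b - 2) = 2 * q + (2 * b - 4)" using \<open>b \<ge> 3\<close> by simp
    have "q + b - 2 + 1 + 1 = q + b" using \<open>b \<ge> 3\<close> by simp
    then have "K * (q + b - 2 + 1) + K = K * q + K * b"
      by (metis distrib_left mult.right_neutral)
    then show "(2 * b - 1) * (q + b - 2 + 1) < K * q + b - 2 + (2 * b - 1) * b"
      unfolding K(1)[symmetric] using K(2) \<open>b \<ge> 3\<close> by linarith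
    show "greedy_count b t \<le> q + b - 2" if "t < a" for t
      using count[OF that] \<open>r = b - 1\<close> by auto
    show "greedy_count b t < q + b - 2 \<and> t \<le> K * q + b - 2 + (b - 2)"
      if "K * q + b - 2 < t" "t < a" for t
      using that aq \<open>r = b - 1\<close> \<open>b \<ge> 3\<close> by simp
  qed
  have case3: "frobenius_number [a, h * a + d, h * a + b * d, h * a + (2 * b - 1) * d] =
      int (q + b - 1) * int h * int a + int (K * q + b - 1) * int d - int a" if "r \<ge> b"
  \<comment> \<open>The incomplete block now contains the remainder \<open>b - 1\<close>, which
    raises the maximal count to \<open>q + b - 1\<close>.\<close>
  proof (rule main[where n = "2 * q" and r = "2 * b - 2"])
    show "K * q + b - 1 < a" using aq that \<open>b \<ge> 3\<close> by linarith
    show "2 * (K * q + b - 1) = (2 * b - 1) * (2 * q) + (2 * b - 2)"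
      unfolding K(1)[symmetric] using \<open>b \<ge> 3\<close> by (simp add: mult.left_commute)
    show "2 * b - 2 < 2 * b - 1" using \<open>b \<ge> 3\<close> by simp
    show "2 * (q + b - 1) = 2 * q + (2 * b - 2)" using \<open>b \<ge> 3\<close> by simp
    have "K * (q + b - 1 + 1) = K * q + K * b"
      using \<open>b \<ge> 3\<close> by (simp flip: distrib_left)
    then show "(2 * b - 1) * (q + b - 1 + 1) < K * q + b - 1 + (2 * b - 1) * b"
      unfolding K(1)[symmetric] using \<open>b \<ge> 3\<close> by linarith
    show "greedy_count b t \<le> q + b - 1" if "t < a" for t
      using count[OF that] r K(1) by (auto split: if_splits)
    \<comment> \<open>Hence \<open>s \<le> 2 * b - 3\<close>: the other costly remainder
      \<open>2 * b - 2\<close> is not reached, and \<open>t - T \<le> b - 2\<close>.\<close>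
    have "r + 2 \<le> 2 * b" using r K by simp
    then show "greedy_count b t < q + b - 1 \<and> t \<le> K * q + b - 1 + (b - 2)"
      if "K * q + b - 1 < t" "t < a" for t
      using count[OF that(2)] that(1) by (auto split: if_splits)
  qed
  have int_diff: "int (q + b - 2) = Q + int b - 2" "int (q + b - 1) = Q + int b - 1"
      "int (K * q - 1) = (2 * int b - 1) * Q - 1"
      "int (K * q + b - 2) = (2 * int b - 1) * Q + int b - 2"
      "int (K * q + b - 1) = (2 * int b - 1) * Q + int b - 1"
    using \<open>b \<ge> 3\<close> K(2) Kq by (simp_all add: of_nat_diff Q intK)
  show ?thesis
  proof (intro conjI impI)
    assume "\<exists>s\<in>{0..b - 2}. [a = s] (mod (2 * b - 1))"
    then have "r \<le> b - 2" using residue K \<open>b \<ge> 3\<close> by auto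
    from case1[OF this] show "frobenius_number [a, h * a + d, h * a + b * d, h * a + (2 * b - 1) * d] =
        (Q + int b - 2) * int h * int a + (2 * int b - 1) * int d * Q - int a - int d"
      unfolding int_diff by (simp add: algebra_simps)
  next
    assume "[a = b - 1] (mod (2 * b - 1))"
    then have "r = b - 1" using residue[of "b - 1"] K \<open>b \<ge> 3\<close> by simp
    from case2[OF this] show "frobenius_number [a, h * a + d, h * a + b * d, h * a + (2 * b - 1) * d] =
        (Q + int b - 2) * int h * int a + (2 * int b - 1) * int d * Q - int a
          + (int b - 2) * int d"
      unfolding int_diff by (simp add: algebra_simps)
  next
    assume "\<exists>s\<in>{b..2 * b - 2}. [a = s] (mod (2 * b - 1))"
    then have "r \<ge> b" using residue K \<open>b \<ge> 3\<close> by auto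
    from case3[OF this] show "frobenius_number [a, h * a + d, h * a + b * d, h * a + (2 * b - 1) * d] =
        (Q + int b - 1) * int h * int a + (2 * int b - 1) * int d * Q - int a
          + (int b - 1) * int d"
      unfolding int_diff by (simp add: algebra_simps)
  qed
qed

end
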